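(* For each integer $m\ge2$ let $r=\frac1{4m}$ and, for real $v$, let $$\Psi_r(v)=\frac{1+v-\sqrt{(1-v)^2+4r}}{2}=\frac{1+v-\sqrt{(1-v)^2+\frac1m}}{2}.$$ Let $(w_k)_{k\ge0}$ be defined by $w_0=\frac12$, $w_{k+1}=\Psi_r(w_k)$, and set $$p_\top(m):=\prod_{k=0}^{m-2}\partial_v\Psi_r(w_k).$$ Then $p_\top(m)\to\frac{1}{\sqrt3}$ as $m\to\infty$.
   Context: Here $\partial_v\Psi_r(v)=\frac12\left(1+\frac{1-v}{\sqrt{(1-v)^2+1/m}}\right)$ is the derivative of $\Psi_r$ with respect to $v$. The sequence $(w_k)$ depends on $m$ through $r$. *)

theory Defs
  imports "HOL-Analysis.Analysis"
begin

definition Psi :: "real \<Rightarrow> real \<Rightarrow> real" where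
  "Psi r v = (1 + v - sqrt ((1 - v)\<^sup>2 + 4 * r)) / 2"

primrec w :: "real \<Rightarrow> nat \<Rightarrow> real" where
  "w r 0 = 1 / 2"
| "w r (Suc k) = Psi r (w r k)"

definition r_of :: "nat \<Rightarrow> real" where
  "r_of m = 1 / (4 * real m)"

text \<open>
  Meaningful for \<open>m \<ge> 2\<close>. For \<open>m < 2\<close> the truncated subtraction \<open>m - 2 = 0\<close> leaves a single
  factor, which is irrelevant for the limit \<open>m \<rightarrow> \<infinity>\<close>.
\<close>
definition p_top :: "nat \<Rightarrow> real" where
  "p_top m = (\<Prod>k = 0..m - 2. deriv (Psi (r_of m)) (w (r_of m) k))"

lemma Psi_r_of:
  assumes "m \<ge> 2"
  shows "Psi (r_of m) v = (1 + v - sqrt ((1 - v)\<^sup>2 + 1 / real m)) / 2"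
  using assms by (simp add: Psi_def r_of_def)

lemma Psi_has_real_derivative:
  assumes "r > 0"
  shows "(Psi r has_real_derivative
           (1 + (1 - v) / sqrt ((1 - v)\<^sup>2 + 4 * r)) / 2) (at v)"
proof -
  have pos: "(1 - v)\<^sup>2 + 4 * r > 0"
    using assms by (simp add: add_nonneg_pos)
  show ?thesis
    unfolding Psi_def [abs_def]
    using pos by (auto intro!: derivative_eq_intros simp: field_simps)
qed

lemma deriv_Psi_r_of:
  assumes "m \<ge> 2"
  shows "deriv (Psi (r_of m)) v =
           1 / 2 * (1 + (1 - v) / sqrt ((1 - v)\<^sup>2 + 1 / real m))"
  using DERIV_imp_deriv [OF Psi_has_real_derivative [of "r_of m" v]] assms
  by (simp add: r_of_def)

end

theory Submission
  imports Defs "HOL-Real_Asymp.Real_Asymp"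
begin

text \<open>
  Put \<open>x\<^sub>k = 1 - w\<^sub>k\<close>. The recursion becomes \<open>x\<^sub>k\<^sub>+\<^sub>1 (x\<^sub>k\<^sub>+\<^sub>1 - x\<^sub>k) = r\<close>, and with
  \<open>u = r / x\<^sub>k\<^sub>+\<^sub>1\<^sup>2\<close> the derivative of \<open>\<Psi>\<^sub>r\<close> at \<open>w\<^sub>k\<close> is \<open>1 / (1 + u)\<close>, while
  \<open>x\<^sub>k / x\<^sub>k\<^sub>+\<^sub>1 = 1 - u\<close>. The two agree up to the factor \<open>1 - u\<^sup>2 = 1 - O(r\<^sup>2)\<close>, so the product
  of \<open>n = m - 1\<close> derivatives is asymptotically the telescoping product \<open>x\<^sub>0 / x\<^sub>n\<close>. Finally
  \<open>x\<^sub>k\<^sub>+\<^sub>1\<^sup>2 = x\<^sub>k\<^sup>2 + 2 r - r u\<close> gives \<open>x\<^sub>n\<^sup>2 \<rightarrow> 1/4 + 1/2 = 3/4\<close>.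
\<close>

definition x :: "real \<Rightarrow> nat \<Rightarrow> real" where
  "x r k = 1 - w r k"

lemma x_0: "x r 0 = 1 / 2"
  by (simp add: x_def)

lemma x_Suc: "x r (Suc k) = (x r k + sqrt ((x r k)\<^sup>2 + 4 * r)) / 2"
  by (simp add: x_def Psi_def field_simps)

lemma x_mono:
  assumes "r > 0"
  shows "x r k \<le> x r (Suc k)"
proof -
  have "x r k \<le> sqrt ((x r k)\<^sup>2 + 4 * r)"
    using assms by (intro real_le_rsqrt) simp
  then show ?thesis
    by (simp add: x_Suc)
qed

lemma x_ge_half:
  assumes "r > 0"
  shows "1 / 2 \<le> x r k"
proof (induction k)
  case (Suc k)
  then show ?case
    using x_mono[OF assms, of k] by linarith
qed (simp add: x_0)

text \<open>By \<open>x_Suc\<close>, \<open>x r (Suc k)\<close> is the positive root of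
  \<open>t^2 - x r k * t - r\<close>.\<close>

lemma x_Suc_quadratic:
  assumes "r > 0"
  shows "x r (Suc k) * (x r (Suc k) - x r k) = r"
proof -
  have "(sqrt ((x r k)\<^sup>2 + 4 * r))\<^sup>2 = (x r k)\<^sup>2 + 4 * r"
    using assms by simp
  then show ?thesis
    unfolding x_Suc by (simp add: power2_eq_square field_simps)
qed

definition u :: "real \<Rightarrow> nat \<Rightarrow> real" where
  "u r k = r / (x r (Suc k))\<^sup>2"

lemma u_bounds:
  assumes "r > 0"
  shows "0 \<le> u r k" "u r k \<le> 4 * r"
proof -
  show "0 \<le> u r k"
    using assms by (simp add: u_def)
  have "(1 / 2)\<^sup>2 \<le> (x r (Suc k))\<^sup>2"
    using x_ge_half[OF assms, of "Suc k"] by (intro power_mono) auto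
  then have "r / (x r (Suc k))\<^sup>2 \<le> r / (1 / 2)\<^sup>2"
    using assms by (intro divide_left_mono) (auto simp: power2_eq_square)
  then show "u r k \<le> 4 * r"
    by (simp add: u_def power2_eq_square)
qed

text \<open>Dividing \<open>x_Suc_quadratic\<close> by the square of \<open>x r (Suc k)\<close>
  identifies \<open>u r k\<close> as the relative increment of \<open>x\<close> at this
  step.\<close>

lemma x_eq_x_Suc_mult:
  assumes "r > 0"
  shows "x r k = x r (Suc k) * (1 - u r k)"
proof -
  have "x r (Suc k) \<noteq> 0"
    using x_ge_half[OF assms, of "Suc k"] by linarith
  then have "x r (Suc k) * u r k = x r (Suc k) - x r k"
    using x_Suc_quadratic[OF assms, of k]
    by (simp add: u_def power2_eq_square divide_eq_eq mult.commute)
  then show ?thesis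
    by (simp add: right_diff_distrib)
qed

lemma deriv_Psi_w:
  assumes "r > 0"
  shows "deriv (Psi r) (w r k) = 1 / (1 + u r k)"
proof -
  define s where "s = sqrt ((x r k)\<^sup>2 + 4 * r)"
  have x1: "x r (Suc k) > 0"
    using x_ge_half[OF assms, of "Suc k"] by linarith
  \<comment> \<open>The recursion expresses the square root rationally in two consecutive terms,
    which removes it from the derivative.\<close>
  have s: "s = 2 * x r (Suc k) - x r k"
    unfolding x_Suc s_def by (simp add: field_simps)
  also have "\<dots> = x r (Suc k) * (1 + u r k)"
    using x_eq_x_Suc_mult[OF assms, of k] by (simp add: algebra_simps)
  finally have s': "s = x r (Suc k) * (1 + u r k)" .
  have u: "1 + u r k > 0"
    using u_bounds[OF assms, of k] by linarith
  have "s > 0"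
    unfolding s' using x1 u by simp
  have "deriv (Psi r) (w r k) = (1 + x r k / s) / 2"
    using DERIV_imp_deriv[OF Psi_has_real_derivative[OF assms, of "w r k"]]
    by (simp add: x_def s_def)
  also have "\<dots> = x r (Suc k) / s"
    using s \<open>s > 0\<close> by (simp add: field_simps)
  also have "\<dots> = 1 / (1 + u r k)"
    using s' x1 by simp
  finally show ?thesis .
qed

text \<open>Each factor lies between \<open>x r k / x r (Suc k)\<close> and that ratio divided by
  \<open>1 - 16 * r^2\<close>. The ratios telescope, and \<open>1 / 2\<close> is the initial value
  \<open>x r 0\<close>.\<close>

lemma prod_deriv_bounds:
  assumes "0 < r" "4 * r < 1"
  defines "P \<equiv> \<lambda>n. \<Prod>k<n. deriv (Psi r) (w r k)"
  shows "1 / 2 \<le> P n * x r n"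
    and "P n * x r n * (1 - 16 * r\<^sup>2) ^ n \<le> 1 / 2"
proof -
  define d where "d k = deriv (Psi r) (w r k)" for k
  have d: "d k > 0" for k
    using u_bounds[OF assms(1), of k] by (simp add: d_def deriv_Psi_w assms)
  \<comment> \<open>This is \<open>1 / (1 + u) = (1 - u) / (1 - u^2)\<close>, cleared of
    denominators.\<close>
  have step: "d k * x r (Suc k) * (1 - (u r k)\<^sup>2) = x r k" for k
  proof -
    have "1 + u r k \<noteq> 0"
      using u_bounds[OF assms(1), of k] by linarith
    then have "d k * (1 - (u r k)\<^sup>2) = 1 - u r k"
      by (simp add: d_def deriv_Psi_w assms field_simps power2_eq_square)
    then show ?thesis
      using x_eq_x_Suc_mult[OF assms(1), of k] by (metis mult.assoc mult.commute)
  qed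
  have pos: "d k * x r (Suc k) \<ge> 0" for k
    using d[of k] x_ge_half[OF assms(1), of "Suc k"] by simp
  have lower: "x r k \<le> d k * x r (Suc k)" for k
    using step[of k] mult_left_mono[OF _ pos[of k], of "1 - (u r k)\<^sup>2" 1] by simp
  have upper: "d k * x r (Suc k) * (1 - 16 * r\<^sup>2) \<le> x r k" for k
  proof -
    have "(u r k)\<^sup>2 \<le> (4 * r)\<^sup>2"
      using u_bounds[OF assms(1), of k] by (intro power_mono) auto
    then show ?thesis
      using mult_left_mono[OF _ pos[of k], of "1 - 16 * r\<^sup>2" "1 - (u r k)\<^sup>2"] step[of k]
      by (simp add: power_mult_distrib)
  qed
  have P: "P n = (\<Prod>k<n. d k)" for n
    by (simp add: P_def d_def)
  have P_pos: "P n > 0" for n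
    unfolding P using d by (intro prod_pos) auto
  \<comment> \<open>The sign lets the second induction multiply \<open>upper\<close> by powers of
    this error factor.\<close>
  have c: "1 - 16 * r\<^sup>2 \<ge> 0"
    using power_mono[of "4 * r" 1 2] assms by (simp add: power_mult_distrib)
  show "1 / 2 \<le> P n * x r n"
  proof (induction n)
    case (Suc n)
    have "P n * x r n \<le> P n * (d n * x r (Suc n))"
      using lower[of n] P_pos[of n] by simp
    with Suc show ?case
      by (simp add: P mult.assoc)
  qed (simp add: P x_0)
  show "P n * x r n * (1 - 16 * r\<^sup>2) ^ n \<le> 1 / 2"
  proof (induction n)
    case (Suc n)
    have "(P n * (1 - 16 * r\<^sup>2) ^ n) * (d n * x r (Suc n) * (1 - 16 * r\<^sup>2))
        \<le> (P n * (1 - 16 * r\<^sup>2) ^ n) * x r n"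
      using upper[of n] P_pos[of n] c by (intro mult_left_mono) auto
    with Suc show ?case
      by (simp add: P mult_ac)
  qed (simp add: P x_0)
qed

text \<open>Squaring \<open>x_eq_x_Suc_mult\<close> shows that the square grows by
  \<open>2 * r - r * u r k\<close> per step. The correction is at most \<open>4 * r^2\<close>, and
  the start is \<open>1 / 4\<close>.\<close>

lemma x_square_bounds:
  assumes "r > 0"
  shows "(x r n)\<^sup>2 \<le> 1 / 4 + 2 * r * real n"
    and "1 / 4 + (2 * r - 4 * r\<^sup>2) * real n \<le> (x r n)\<^sup>2"
proof -
  have step: "(x r (Suc k))\<^sup>2 = (x r k)\<^sup>2 + 2 * r - r * u r k" for k
  proof -
    have "x r (Suc k) \<noteq> 0"
      using x_ge_half[OF assms, of "Suc k"] by linarith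
    then have r: "(x r (Suc k))\<^sup>2 * u r k = r"
      by (simp add: u_def)
    have "(x r k)\<^sup>2 = (x r (Suc k))\<^sup>2 * (1 - u r k)\<^sup>2"
      using x_eq_x_Suc_mult[OF assms, of k] by (metis power_mult_distrib)
    also have "\<dots> = (x r (Suc k))\<^sup>2 - 2 * ((x r (Suc k))\<^sup>2 * u r k)
        + ((x r (Suc k))\<^sup>2 * u r k) * u r k"
      by (simp add: power2_eq_square algebra_simps)
    finally show ?thesis
      by (simp add: r)
  qed
  have ru: "0 \<le> r * u r k" "r * u r k \<le> 4 * r\<^sup>2" for k
    using u_bounds[OF assms, of k] mult_left_mono[of "u r k" "4 * r" r] assms
    by (auto simp: power2_eq_square)
  show "(x r n)\<^sup>2 \<le> 1 / 4 + 2 * r * real n"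
  proof (induction n)
    case (Suc n)
    then show ?case
      using step[of n] ru[of n] by (simp add: algebra_simps)
  qed (simp add: x_0 power2_eq_square)
  show "1 / 4 + (2 * r - 4 * r\<^sup>2) * real n \<le> (x r n)\<^sup>2"
  proof (induction n)
    case (Suc n)
    then show ?case
      using step[of n] ru[of n] by (simp add: algebra_simps)
  qed (simp add: x_0 power2_eq_square)
qed

text \<open>The index \<open>m - 1\<close> is the number of factors of \<open>p_top m\<close> for
  \<open>m \<ge> 2\<close>. With \<open>r = 1 / (4 * m)\<close>, the main term
  \<open>2 * r * (m - 1)\<close> tends to \<open>1 / 2\<close> and the correction
  \<open>4 * r^2 * (m - 1)\<close> to 0.\<close>

lemma x_tendsto: "(\<lambda>m. x (r_of m) (m - 1)) \<longlonglongrightarrow> sqrt 3 / 2"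
proof -
  have "(\<lambda>m. (x (r_of m) (m - 1))\<^sup>2) \<longlonglongrightarrow> 3 / 4"
  proof (rule tendsto_sandwich)
    show "\<forall>\<^sub>F m in sequentially. 1 / 4 + (2 * r_of m - 4 * (r_of m)\<^sup>2) * real (m - 1)
        \<le> (x (r_of m) (m - 1))\<^sup>2"
      using eventually_gt_at_top[of 0]
      by eventually_elim (intro x_square_bounds, simp add: r_of_def)
    show "\<forall>\<^sub>F m in sequentially. (x (r_of m) (m - 1))\<^sup>2 \<le> 1 / 4 + 2 * r_of m * real (m - 1)"
      using eventually_gt_at_top[of 0]
      by eventually_elim (intro x_square_bounds, simp add: r_of_def)
    have m: "\<forall>\<^sub>F m in sequentially. real (m - 1) = real m - 1"
      using eventually_gt_at_top[of 0] by eventually_elim (simp add: of_nat_diff)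
    have "(\<lambda>m. 1 / 4 + (2 * r_of m - 4 * (r_of m)\<^sup>2) * (real m - 1)) \<longlonglongrightarrow> 3 / 4"
      unfolding r_of_def by real_asymp
    then show "(\<lambda>m. 1 / 4 + (2 * r_of m - 4 * (r_of m)\<^sup>2) * real (m - 1)) \<longlonglongrightarrow> 3 / 4"
      by (rule Lim_transform_eventually) (use m in eventually_elim, simp)
    have "(\<lambda>m. 1 / 4 + 2 * r_of m * (real m - 1)) \<longlonglongrightarrow> 3 / 4"
      unfolding r_of_def by real_asymp
    then show "(\<lambda>m. 1 / 4 + 2 * r_of m * real (m - 1)) \<longlonglongrightarrow> 3 / 4"
      by (rule Lim_transform_eventually) (use m in eventually_elim, simp)
  qed
  then have "(\<lambda>m. sqrt ((x (r_of m) (m - 1))\<^sup>2)) \<longlonglongrightarrow> sqrt (3 / 4)"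
    by (rule tendsto_real_sqrt)
  then have "(\<lambda>m. sqrt ((x (r_of m) (m - 1))\<^sup>2)) \<longlonglongrightarrow> sqrt 3 / 2"
    by (simp add: real_sqrt_divide)
  moreover have "\<forall>\<^sub>F m in sequentially. sqrt ((x (r_of m) (m - 1))\<^sup>2) = x (r_of m) (m - 1)"
    using eventually_gt_at_top[of 0]
  proof eventually_elim
    case (elim m)
    then show ?case
      using x_ge_half[of "r_of m" "m - 1"] by (simp add: r_of_def)
  qed
  ultimately show ?thesis
    by (rule Lim_transform_eventually)
qed

theorem theorem4:
  shows "p_top \<longlonglongrightarrow> 1 / sqrt 3"
proof -
  define y where "y m = x (r_of m) (m - 1)" for m
  define q where "q m = (1 - 16 * (r_of m)\<^sup>2) ^ (m - 1)" for m
  have y: "y \<longlonglongrightarrow> sqrt 3 / 2"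
    unfolding y_def by (rule x_tendsto)
  \<comment> \<open>Here \<open>16 * r^2 = 1 / m^2\<close>, so \<open>m - 1\<close> such factors
    lose only \<open>O(1 / m)\<close> in total. The real exponent gives a form suited to
    \<open>real_asymp\<close>.\<close>
  have "(\<lambda>m::nat. (1 - 16 * (1 / (4 * real m))\<^sup>2) powr (real m - 1)) \<longlonglongrightarrow> 1"
    by real_asymp
  moreover have "\<forall>\<^sub>F m::nat in sequentially.
      (1 - 16 * (1 / (4 * real m))\<^sup>2) powr (real m - 1) = q m"
    using eventually_ge_at_top[of 2]
  proof eventually_elim
    case (elim m)
    have "(1 / real m)\<^sup>2 < 1\<^sup>2"
      using elim by (intro power_strict_mono) auto
    then have "1 - 16 * (1 / (4 * real m))\<^sup>2 > 0"
      by (simp add: power_divide power_mult_distrib)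
    then have "(1 - 16 * (1 / (4 * real m))\<^sup>2) powr real (m - 1) = q m"
      unfolding q_def r_of_def by (rule powr_realpow)
    then show ?case
      using elim by (simp add: of_nat_diff)
  qed
  ultimately have q: "q \<longlonglongrightarrow> 1"
    by (rule Lim_transform_eventually)
  have bounds: "\<forall>\<^sub>F m in sequentially.
      1 / 2 / y m \<le> p_top m \<and> p_top m \<le> 1 / 2 / (y m * q m)"
    \<comment> \<open>Since \<open>q\<close> tends to 1, it is eventually positive, so the upper
      bound may be divided by \<open>y m * q m\<close>.\<close>
    using eventually_ge_at_top[of 2] order_tendstoD(1)[OF q zero_less_one]
  proof eventually_elim
    case (elim m)
    have r: "0 < r_of m" "4 * r_of m < 1"
      using elim by (auto simp: r_of_def)
    have "{0..m - 2} = {..<m - 1}"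
      using elim by auto
    then have p: "p_top m = (\<Prod>k<m - 1. deriv (Psi (r_of m)) (w (r_of m) k))"
      by (simp add: p_top_def)
    have "y m > 0"
      using x_ge_half[OF r(1), of "m - 1"] unfolding y_def by linarith
    moreover have "y m * q m > 0"
      using \<open>y m > 0\<close> elim by simp
    ultimately show ?case
      using prod_deriv_bounds[OF r, of "m - 1"]
      unfolding p[symmetric] y_def[symmetric] q_def[symmetric]
      by (simp add: pos_divide_le_eq pos_le_divide_eq mult.assoc)
  qed
  \<comment> \<open>Both enclosing sequences have the limit \<open>1 / sqrt 3\<close>.\<close>
  have "(\<lambda>m. 1 / 2 / y m) \<longlonglongrightarrow> 1 / 2 / (sqrt 3 / 2)"
    by (intro tendsto_intros y) simp
  moreover have "(\<lambda>m. 1 / 2 / (y m * q m)) \<longlonglongrightarrow> 1 / 2 / (sqrt 3 / 2 * 1)"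
    by (intro tendsto_intros y q) simp
  ultimately show ?thesis
    using tendsto_sandwich[of "\<lambda>m. 1 / 2 / y m" p_top sequentially "\<lambda>m. 1 / 2 / (y m * q m)"]
      bounds by (simp add: eventually_conj_iff)
qed

end
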